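(* Let $\ell$ denote the one-dimensional Lebesgue measure. Let $h : (0,1) \to (0,1)$ be a Borel measurable map preserving the Lebesgue measure $\ell$ on $(0,1)$. Let $j : (0,1] \to \mathbb{R}$ be a Borel measurable map such that $\ell(\{x \in (0,1] : j(x) = c\}) < 1$ for every $c \in \mathbb{R}$. Then there do not exist Borel measurable functions $f, g : (0,1) \to (0,1)$ such that $$f(x) + g(y) = j\left(\min\left\{\frac{h(x)}{y}, \frac{1-h(x)}{1-y}\right\}\right) \quad \text{for all } x, y \in (0,1).$$
   Context: A Borel measurable map $h:(0,1)\to(0,1)$ preserves the Lebesgue measure $\ell$ if $\ell(h^{-1}(A)) = \ell(A)$ for every Borel set $A \subseteq (0,1)$. Note that for $x,y\in(0,1)$ the quantity $\min\{h(x)/y,(1-h(x))/(1-y)\}$ lies in $(0,1]$, so the right-hand side is well defined. *)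

theory Defs
  imports "HOL-Analysis.Analysis"
begin

text \<open>
  The open unit interval as a measurable space with its Borel sets. Functions on an interval are
  modelled as total functions on the reals whose values outside the interval are irrelevant;
  membership in \<open>unit_borel \<rightarrow>\<^sub>M unit_borel\<close> includes that the open interval is mapped into itself.
\<close>

abbreviation unit_borel :: "real measure" where
  "unit_borel \<equiv> restrict_space borel {0<..<1}"

definition preserves_lebesgue :: "(real \<Rightarrow> real) \<Rightarrow> bool" where
  "preserves_lebesgue h \<longleftrightarrow>
    (\<forall>A \<in> sets borel. A \<subseteq> {0<..<1} \<longrightarrow>
      emeasure lborel (h -` A \<inter> {0<..<1}) = emeasure lborel A)"

end

theory Submission
  imports Defs
begin

text \<open>
  For fixed \<open>y\<close>, the map \<open>u \<mapsto> min (u / y) ((1 - u) / (1 - y))\<close> preserves Lebesgue measure on the unit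
  interval: it stretches \<open>(0, y)\<close> and \<open>(y, 1)\<close> linearly onto \<open>(0, 1)\<close>. Integrating the functional
  equation over \<open>x\<close> therefore gives \<open>\<integral> f + g y = \<integral> j\<close> for every \<open>y\<close>, so \<open>g\<close> is constant. Setting
  \<open>y = h x\<close> then shows that \<open>f\<close> is constant, too. Since \<open>h\<close> takes arbitrarily small values, every
  point of \<open>(0, 1]\<close> occurs as an argument of \<open>j\<close>, and so \<open>j\<close> is constant on \<open>(0, 1]\<close>.
\<close>

text \<open>Turns invariance of sets into an identity of pushforward measures, the form in which
  \<open>integral_distr\<close> can remove \<open>h\<close> from an integrand.\<close>

lemma distr_preserves_lebesgue:
  assumes "h \<in> unit_borel \<rightarrow>\<^sub>M unit_borel" "preserves_lebesgue h"
  defines "M \<equiv> restrict_space lborel {0<..<1::real}"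
  shows "distr M M h = M"
proof (rule measure_eqI)
  have sets_M: "sets M = sets unit_borel"
    unfolding M_def by (rule sets_restrict_space_cong) simp
  then have h: "h \<in> M \<rightarrow>\<^sub>M M"
    using assms(1) measurable_cong_sets[OF sets_M sets_M] by simp
  fix A assume "A \<in> sets (distr M M h)"
  then have A: "A \<in> sets M" by simp
  then have Ab: "A \<in> sets borel" "A \<subseteq> {0<..<1}"
    unfolding M_def by (auto simp: sets_restrict_space_iff)
  have "emeasure (distr M M h) A = emeasure M (h -` A \<inter> {0<..<1})"
    using h A by (simp add: emeasure_distr M_def)
  also have "\<dots> = emeasure lborel (h -` A \<inter> {0<..<1})"
    unfolding M_def by (intro emeasure_restrict_space) auto
  also have "\<dots> = emeasure lborel A"
    using assms(2) Ab unfolding preserves_lebesgue_def by blast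
  also have "\<dots> = emeasure M A"
    unfolding M_def using Ab by (intro emeasure_restrict_space[symmetric]) auto
  finally show "emeasure (distr M M h) A = emeasure M A" .
qed simp

text \<open>The preimage of the interval from 0 to \<open>t\<close> has measure
  \<open>t > 0\<close>, so it cannot be empty.\<close>

lemma preserves_lebesgue_small_value:
  assumes "preserves_lebesgue h" "0 < t" "t \<le> 1"
  obtains x where "x \<in> {0<..<1}" "0 < h x" "h x < t"
proof -
  have "emeasure lborel (h -` {0<..<t} \<inter> {0<..<1}) = emeasure lborel {0<..<t}"
    by (rule assms(1)[unfolded preserves_lebesgue_def, rule_format]) (use assms in auto)
  also have "\<dots> > 0" using assms by simp
  finally have "h -` {0<..<t} \<inter> {0<..<1} \<noteq> {}" by force
  then obtain x where "x \<in> {0<..<1}" "h x \<in> {0<..<t}" by blast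
  then show thesis using that[of x] by simp
qed

lemma min_ratio_left:
  fixes u y :: real
  assumes "0 < u" "u \<le> y" "y < 1"
  shows "min (u / y) ((1 - u) / (1 - y)) = u / y"
proof -
  have "u / y \<le> 1" "1 \<le> (1 - u) / (1 - y)" using assms by auto
  then show ?thesis by linarith
qed

lemma min_ratio_right:
  fixes u y :: real
  assumes "0 < y" "y \<le> u" "u < 1"
  shows "min (u / y) ((1 - u) / (1 - y)) = (1 - u) / (1 - y)"
proof -
  have "1 \<le> u / y" "(1 - u) / (1 - y) \<le> 1" using assms by auto
  then show ?thesis by linarith
qed

text \<open>The indicator term covers the point \<open>u = y\<close>, where both ratios are 1 and \<open>J\<close> vanishes.\<close>

lemma min_ratio_split:
  fixes j :: "real \<Rightarrow> real" and u y :: real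
  assumes "u \<in> {0<..<1}" "y \<in> {0<..<1}"
  defines "J \<equiv> \<lambda>t. indicator {0<..<1} t * j t"
  shows "j (min (u / y) ((1 - u) / (1 - y))) =
    J (u / y) + J ((1 - u) / (1 - y)) + j 1 * indicator {y} u"
proof (cases u y rule: linorder_cases)
  case less
  then have "u / y < 1" "0 < u / y" "1 < (1 - u) / (1 - y)" using assms by auto
  moreover have "min (u / y) ((1 - u) / (1 - y)) = u / y"
    using less assms by (intro min_ratio_left) auto
  ultimately show ?thesis using less by (simp only: J_def) simp
next
  case equal
  then show ?thesis using assms by (simp add: J_def)
next
  case greater
  then have "1 < u / y" "0 < (1 - u) / (1 - y)" "(1 - u) / (1 - y) < 1" using assms by auto
  moreover have "min (u / y) ((1 - u) / (1 - y)) = (1 - u) / (1 - y)"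
    using greater assms by (intro min_ratio_right) auto
  ultimately show ?thesis using greater by (simp only: J_def) simp
qed

text \<open>The substitutions \<open>t = u / y\<close> and \<open>t = (1 - u) / (1 - y)\<close>
  scale the integral of \<open>J\<close> by \<open>y\<close> and \<open>1 - y\<close>, and these
  weights add up to 1. The term at the single point \<open>y\<close> contributes nothing.\<close>

lemma integral_stretch_split:
  fixes J :: "real \<Rightarrow> real" and c y :: real
  assumes J: "integrable lborel J" and zero: "\<And>t. t \<notin> {0<..<1} \<Longrightarrow> J t = 0"
    and y: "y \<in> {0<..<1}"
  shows "(LINT u|restrict_space lborel {0<..<1}.
      J (u / y) + J ((1 - u) / (1 - y)) + c * indicator {y} u) = integral\<^sup>L lborel J"
proof -
  \<comment> \<open>Written as offset plus slope times \<open>u\<close>, to match the affine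
    substitution rules for \<open>lborel\<close>.\<close>
  have ratio_right: "(1 - u) / (1 - y) = 1 / (1 - y) + (- 1 / (1 - y)) * u" for u
    by (simp add: diff_divide_distrib)
  have int1: "integrable lborel (\<lambda>u. J (u / y))"
    using lborel_integrable_real_affine[OF J, of "1 / y" 0] y by simp
  have int2: "integrable lborel (\<lambda>u. J ((1 - u) / (1 - y)))"
    unfolding ratio_right by (rule lborel_integrable_real_affine[OF J]) (use y in simp)
  have val1: "(LINT u|lborel. J (u / y)) = y * integral\<^sup>L lborel J"
    using lborel_integral_real_affine[of "1 / y" J 0] y by (simp add: field_simps)
  have val2: "(LINT u|lborel. J ((1 - u) / (1 - y))) = (1 - y) * integral\<^sup>L lborel J"
    unfolding ratio_right using lborel_integral_real_affine[of "- 1 / (1 - y)" J "1 / (1 - y)"] y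
    by simp
  have "(LINT u|restrict_space lborel {0<..<1}.
      J (u / y) + J ((1 - u) / (1 - y)) + c * indicator {y} u) =
    (LINT u|lborel. indicator {0<..<1} u *
      (J (u / y) + J ((1 - u) / (1 - y)) + c * indicator {y} u))"
    by (subst integral_restrict_space) (auto simp: mult.commute)
  also have "\<dots> = (LINT u|lborel. J (u / y) + J ((1 - u) / (1 - y)) + c * indicator {y} u)"
  proof (rule Bochner_Integration.integral_cong)
    fix u :: real
    show "indicator {0<..<1} u * (J (u / y) + J ((1 - u) / (1 - y)) + c * indicator {y} u) =
      J (u / y) + J ((1 - u) / (1 - y)) + c * indicator {y} u"
    proof (cases "u \<in> {0<..<1}")
      case False
      then have "u \<le> 0 \<or> 1 \<le> u" by auto
      then have "u / y \<notin> {0<..<1}" "(1 - u) / (1 - y) \<notin> {0<..<1}" "u \<noteq> y"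
        using y by (auto simp: divide_le_0_iff le_divide_eq divide_less_eq zero_less_divide_iff)
      then show ?thesis using zero by simp
    qed simp
  qed simp
  also have "\<dots> = y * integral\<^sup>L lborel J + (1 - y) * integral\<^sup>L lborel J"
    using int1 int2 by (simp add: val1 val2)
  finally show ?thesis by (simp add: algebra_simps)
qed

theorem theorem1p1:
  fixes h j :: "real \<Rightarrow> real"
  assumes "h \<in> unit_borel \<rightarrow>\<^sub>M unit_borel"
    and "preserves_lebesgue h"
    and "j \<in> restrict_space borel {0<..1} \<rightarrow>\<^sub>M borel"
    and "\<And>c :: real. emeasure lborel {x \<in> {0<..1}. j x = c} < 1"
  shows "\<not> (\<exists>f g :: real \<Rightarrow> real.
      f \<in> unit_borel \<rightarrow>\<^sub>M unit_borel \<and>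
      g \<in> unit_borel \<rightarrow>\<^sub>M unit_borel \<and>
      (\<forall>x \<in> {0<..<1}. \<forall>y \<in> {0<..<1}.
        f x + g y = j (min (h x / y) ((1 - h x) / (1 - y)))))"
proof
  assume "\<exists>f g :: real \<Rightarrow> real.
      f \<in> unit_borel \<rightarrow>\<^sub>M unit_borel \<and>
      g \<in> unit_borel \<rightarrow>\<^sub>M unit_borel \<and>
      (\<forall>x \<in> {0<..<1}. \<forall>y \<in> {0<..<1}.
        f x + g y = j (min (h x / y) ((1 - h x) / (1 - y))))"
  then obtain f g where f: "f \<in> unit_borel \<rightarrow>\<^sub>M unit_borel"
    and g: "g \<in> unit_borel \<rightarrow>\<^sub>M unit_borel"
    and eq: "\<And>x y. x \<in> {0<..<1} \<Longrightarrow> y \<in> {0<..<1} \<Longrightarrow>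
      f x + g y = j (min (h x / y) ((1 - h x) / (1 - y)))"
    by blast
  have range: "k x \<in> {0<..<1}" if "k \<in> unit_borel \<rightarrow>\<^sub>M unit_borel" "x \<in> {0<..<1}"
    for k :: "real \<Rightarrow> real" and x
    using measurable_space[OF that(1), of x] that(2) by simp
  \<comment> \<open>Choose \<open>x\<close> with \<open>h x < t\<close> and put
    \<open>y = h x / t\<close>. Then \<open>h x \<le> y < 1\<close>, so the minimum is the first
    ratio, which equals \<open>t\<close>.\<close>
  have j_value: "\<exists>x\<in>{0<..<1}. \<exists>y\<in>{0<..<1}. j t = f x + g y" if t: "t \<in> {0<..1}" for t
  proof -
    obtain x where x: "x \<in> {0<..<1}" "0 < h x" "h x < t"
      using preserves_lebesgue_small_value[OF assms(2)] t by auto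
    have y: "h x / t \<in> {0<..<1}" using x t by simp
    have "h x \<le> h x / t" using x t by (simp add: le_divide_eq mult_left_le)
    then have "f x + g (h x / t) = j t"
      using eq[OF x(1) y] min_ratio_left[of "h x" "h x / t"] x t y by simp
    then show ?thesis using x(1) y by metis
  qed
  define M where "M = restrict_space lborel {0<..<1::real}"
  have sets_M: "sets M = sets unit_borel"
    unfolding M_def by (rule sets_restrict_space_cong) simp
  have space_M: "space M = {0<..<1}"
    unfolding M_def by simp
  have emeasure_M: "emeasure M (space M) = 1"
    unfolding space_M unfolding M_def by (subst emeasure_restrict_space) auto
  interpret finite_measure M
    by (rule finite_measureI) (simp add: emeasure_M)
  have h_M: "h \<in> M \<rightarrow>\<^sub>M M"
    using assms(1) measurable_cong_sets[OF sets_M sets_M] by simp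
  have "f \<in> unit_borel \<rightarrow>\<^sub>M borel"
    using f by (simp add: measurable_restrict_space2_iff)
  then have "f \<in> borel_measurable M"
    by (simp only: measurable_cong_sets[OF sets_M refl])
  moreover have "AE x in M. norm (f x) \<le> 1"
  proof (rule AE_I2)
    fix x assume "x \<in> space M"
    then have "f x \<in> {0<..<1}" using range[OF f] by (simp add: space_M)
    then show "norm (f x) \<le> 1" by simp
  qed
  ultimately have int_f: "integrable M f"
    by (intro integrable_const_bound)
  \<comment> \<open>Extending \<open>j\<close> by zero makes it a function on the whole line. The
    point 1 is left out because both ratios take that value at \<open>u = y\<close>; it is accounted
    for separately.\<close>
  define J where "J = (\<lambda>t. indicator {0<..<1} t * j t)"
  have "(\<lambda>t. indicator {0<..1} t *\<^sub>R j t) \<in> borel_measurable borel"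
    using assms(3) by (subst (asm) borel_measurable_restrict_space_iff) auto
  then have "(\<lambda>t. indicator {0<..<1} t * (indicator {0<..1} t *\<^sub>R j t)) \<in> borel_measurable borel"
    by measurable
  also have "(\<lambda>t. indicator {0<..<1} t * (indicator {0<..1} t *\<^sub>R j t)) = J"
    by (auto simp: J_def fun_eq_iff indicator_def)
  finally have J_meas [measurable]: "J \<in> borel_measurable borel" .
  \<comment> \<open>No bound on \<open>j\<close> is assumed; it comes from the equation, since each
    value of \<open>j\<close> on the unit interval is a sum of two numbers between 0 and 1.\<close>
  have J_bound: "norm (J t) \<le> norm (indicator {0<..<1} t *\<^sub>R (2::real))" for t
  proof (cases "t \<in> {0<..<1}")
    case True
    then obtain x y where "x \<in> {0<..<1}" "y \<in> {0<..<1}" "j t = f x + g y"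
      using j_value[of t] by auto
    then show ?thesis using range[OF f, of x] range[OF g, of y] True by (simp add: J_def)
  qed (simp add: J_def)
  have int_J: "integrable lborel J"
  proof (rule Bochner_Integration.integrable_bound)
    show "integrable lborel (\<lambda>t. indicator {0<..<1::real} t *\<^sub>R (2::real))" by simp
  qed (simp, rule AE_I2, rule J_bound)
  have g_eq: "g y = integral\<^sup>L lborel J - integral\<^sup>L M f" if y: "y \<in> {0<..<1}" for y
  proof -
    define G where "G = (\<lambda>u. J (u / y) + J ((1 - u) / (1 - y)) + j 1 * indicator {y} u)"
    have "G \<in> borel_measurable borel" unfolding G_def by measurable
    then have G: "G \<in> borel_measurable M"
      unfolding M_def by (intro measurable_restrict_space1) simp
    \<comment> \<open>Integration is over \<open>x\<close> with \<open>y\<close> fixed;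
      \<open>g y\<close> survives unchanged because \<open>M\<close> has total mass 1.\<close>
    have "integral\<^sup>L M f + g y = (LINT x|M. f x + g y)"
      using int_f emeasure_M by (simp add: measure_def)
    also have "\<dots> = (LINT x|M. G (h x))"
    proof (rule Bochner_Integration.integral_cong)
      fix x assume "x \<in> space M"
      then have x: "x \<in> {0<..<1}" by (simp add: space_M)
      show "f x + g y = G (h x)"
        using eq[OF x y] min_ratio_split[OF range[OF assms(1) x] y, of j]
        by (simp add: G_def J_def)
    qed simp
    also have "\<dots> = integral\<^sup>L (distr M M h) G"
      using integral_distr[OF h_M G] by simp
    also have "\<dots> = integral\<^sup>L M G"
      using distr_preserves_lebesgue[OF assms(1,2)] by (simp add: M_def)
    also have "\<dots> = integral\<^sup>L lborel J"
      unfolding M_def G_def by (rule integral_stretch_split[OF int_J _ y]) (simp add: J_def)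
    finally show ?thesis by simp
  qed
  have "j t = j 1" if t: "t \<in> {0<..1}" for t
  proof -
    obtain x y where x: "x \<in> {0<..<1}" and y: "y \<in> {0<..<1}" and j_t: "j t = f x + g y"
      using j_value[OF t] by auto
    note j_t
    \<comment> \<open>As \<open>g\<close> is constant, \<open>y\<close> may be moved to
      \<open>h x\<close>, where both ratios equal 1.\<close>
    also have "f x + g y = f x + g (h x)"
      using g_eq[OF y] g_eq[OF range[OF assms(1) x]] by simp
    also have "\<dots> = j 1"
      using eq[OF x range[OF assms(1) x]] range[OF assms(1) x] by simp
    finally show ?thesis .
  qed
  \<comment> \<open>The level set of \<open>j\<close> at the value \<open>j 1\<close> has full
    measure 1, against the hypothesis on level sets.\<close>
  then have "{x \<in> {0<..1}. j x = j 1} = {0<..1}" by blast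
  then show False using assms(4)[of "j 1"] by simp
qed

end
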